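(* Let $\mathcal{A}=\langle Q,\Sigma\rangle$ be a complete deterministic finite automaton with state set $Q=\{1,2,\dots,n\}$ and input alphabet $\Sigma=\{\sigma_1,\dots,\sigma_k\}$. Let $\mathbb{H}(\mathcal{A})=\langle R,\Theta\rangle$ be the automaton with state set $R=Q\cup Q'$, where $Q'=\{1',2',\dots,n'\}$ is a copy of $Q$ disjoint from $Q$, and with input alphabet $\Theta=\{a_1,\dots,a_k,b\}$ consisting of $k+1$ distinct letters, whose transitions are \[ i.a_j:=i,\qquad i'.a_j:=i.\sigma_j\qquad\text{for all } i=1,\dots,n,\ j=1,\dots,k, \] \[ i.b:=i',\qquad i'.b:=i'\qquad\text{for all } i=1,\dots,n, \] where $i.\sigma_j$ is computed in $\mathcal{A}$. Then each letter in $\Theta$ acts on $R$ as an idempotent selfmap and has rank $\frac{|R|}{2}$.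
   Context: A complete deterministic finite automaton (DFA) $\langle Q,\Sigma\rangle$ consists of a finite state set $Q$, a finite input alphabet $\Sigma$, and a totally defined transition function $Q\times\Sigma\to Q$, written $(q,a)\mapsto q.a$. A letter $a$ acts as an idempotent selfmap on the state set $Q$ if $(q.a).a=q.a$ for every $q\in Q$. The rank of a letter $a$ is the cardinality of the set $Q.a=\{q.a\mid q\in Q\}$. *)

theory Defs
  imports Complex_Main
begin

text \<open>The transition function is total on the types; only its values on the carriers
  \<open>states\<close> and \<open>alphabet\<close> are meaningful, and \<open>complete_dfa\<close> requires that they stay
  inside \<open>states\<close>.\<close>

record ('q, 's) automaton =
  states :: "'q set"
  alphabet :: "'s set"
  step :: "'q \<Rightarrow> 's \<Rightarrow> 'q"

definition complete_dfa :: "('q, 's) automaton \<Rightarrow> bool" where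
  "complete_dfa A \<longleftrightarrow> finite (states A) \<and> finite (alphabet A) \<and>
     (\<forall>q \<in> states A. \<forall>a \<in> alphabet A. step A q a \<in> states A)"

definition idempotent_selfmap :: "('q, 's) automaton \<Rightarrow> 's \<Rightarrow> bool" where
  "idempotent_selfmap A a \<longleftrightarrow>
     (\<forall>q \<in> states A. step A q a \<in> states A) \<and>
     (\<forall>q \<in> states A. step A (step A q a) a = step A q a)"

definition letter_rank :: "('q, 's) automaton \<Rightarrow> 's \<Rightarrow> nat" where
  "letter_rank A a = card ((\<lambda>q. step A q a) ` states A)"

text \<open>The letters \<open>a\<^sub>j\<close> and \<open>b\<close> of the automaton \<open>H A\<close>; being constructor terms, they are
  pairwise distinct.\<close>

datatype hletter = Let_a nat | Let_b

text \<open>A state \<open>i\<close> is represented by \<open>Inl i\<close> and its copy \<open>i'\<close> by \<open>Inr i\<close>.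
  The function \<open>\<sigma>\<close> enumerates the input letters of the given automaton.\<close>

fun h_step :: "('q, 's) automaton \<Rightarrow> (nat \<Rightarrow> 's) \<Rightarrow> 'q + 'q \<Rightarrow> hletter \<Rightarrow> 'q + 'q" where
  "h_step A \<sigma> (Inl i) (Let_a j) = Inl i"
| "h_step A \<sigma> (Inr i) (Let_a j) = Inl (step A i (\<sigma> j))"
| "h_step A \<sigma> (Inl i) Let_b = Inr i"
| "h_step A \<sigma> (Inr i) Let_b = Inr i"

definition H :: "('q, 's) automaton \<Rightarrow> nat \<Rightarrow> (nat \<Rightarrow> 's) \<Rightarrow> ('q + 'q, hletter) automaton" where
  "H A k \<sigma> = \<lparr> states = states A <+> states A,
               alphabet = insert Let_b (Let_a ` {1..k}),
               step = h_step A \<sigma> \<rparr>"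

end

theory Submission
  imports Defs
begin

text \<open>Each letter retracts the doubled state set onto one of its two halves:
  \<open>Let_b\<close> fixes the copy \<open>Inr\<close> pointwise and sends the other half onto it,
  while \<open>Let_a j\<close> fixes the half \<open>Inl\<close> pointwise and sends the copy into
  it. A map that fixes its image pointwise is idempotent, and each half has half of all the states.
  The two image lemmas carry the rank claim.\<close>

lemma card_states_H:
  assumes "finite (states A)"
  shows "card (states (H A k \<sigma>)) = 2 * card (states A)"
  using assms by (simp add: H_def card_Plus)

lemma image_letter_b:
  "(\<lambda>q. step (H A k \<sigma>) q Let_b) ` states (H A k \<sigma>) = Inr ` states A"
  unfolding H_def Plus_def by (auto simp: image_Un image_image)

text \<open>Completeness of \<open>A\<close> keeps the images of the copy \<open>Inr\<close> inside
  \<open>Inl\<close>; equality follows because every \<open>Inl i\<close> is fixed, even if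
  \<open>\<sigma> j\<close> is not surjective on the states.\<close>

lemma image_letter_a:
  assumes "complete_dfa A" "\<sigma> j \<in> alphabet A"
  shows "(\<lambda>q. step (H A k \<sigma>) q (Let_a j)) ` states (H A k \<sigma>) = Inl ` states A"
  using assms unfolding H_def Plus_def complete_dfa_def by (auto simp: image_Un image_image)

lemma idempotent_letter_b: "idempotent_selfmap (H A k \<sigma>) Let_b"
  unfolding idempotent_selfmap_def H_def by auto

lemma idempotent_letter_a:
  assumes "complete_dfa A" "\<sigma> j \<in> alphabet A"
  shows "idempotent_selfmap (H A k \<sigma>) (Let_a j)"
  using assms unfolding idempotent_selfmap_def H_def complete_dfa_def by auto

theorem lemma1:
  fixes A :: "(nat, 's) automaton" and n k :: nat and \<sigma> :: "nat \<Rightarrow> 's"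
  assumes "complete_dfa A"
    and "states A = {1..n}"
    and "alphabet A = \<sigma> ` {1..k}"
  shows "\<forall>c \<in> alphabet (H A k \<sigma>).
    idempotent_selfmap (H A k \<sigma>) c \<and>
    real (letter_rank (H A k \<sigma>) c) = real (card (states (H A k \<sigma>))) / 2"
proof
  fix c
  assume "c \<in> alphabet (H A k \<sigma>)"
  then consider "c = Let_b" | j where "c = Let_a j" "\<sigma> j \<in> alphabet A"
    using assms(3) by (auto simp: H_def)
  \<comment> \<open>The rank is first found as a natural number, by injectivity of
    \<open>Inl\<close> and \<open>Inr\<close>; halving in the reals is left to the end.\<close>
  then have "idempotent_selfmap (H A k \<sigma>) c \<and> letter_rank (H A k \<sigma>) c = card (states A)"
    by cases (simp_all add: assms(1) letter_rank_def card_image image_letter_a image_letter_b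
        idempotent_letter_a idempotent_letter_b)
  moreover have "card (states (H A k \<sigma>)) = 2 * card (states A)"
    using assms(1) by (simp add: card_states_H complete_dfa_def)
  ultimately show "idempotent_selfmap (H A k \<sigma>) c \<and>
      real (letter_rank (H A k \<sigma>) c) = real (card (states (H A k \<sigma>))) / 2"
    by simp
qed

end
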